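(* Let $\eta\ge 1$ be an integer and let $\varphi:\mathbb{R}\to\mathbb{R}$, $A:\mathbb{R}\to\mathbb{R}$, $W:\mathbb{R}\to\mathbb{R}$, and, for $j=1,\dots,\eta$, $U_j,L_j,M_j,V_j:\mathbb{R}\to\mathbb{R}\cup\{\pm\infty\}$ be monotonic and right continuous functions such that: (cc1) $\varphi$ is a cumulative distribution function (cdf), and $A$ and $W$ are non-negative; (cc2) $A$, $U_j$ and $M_j$ are non-decreasing and $W$, $V_j$ and $L_j$ are non-increasing, for all $j=1,\dots,\eta$; (cc3) if $\lim_{x\to+\infty}W(x)\neq\lim_{x\to+\infty}A(x)$, then [$\lim_{x\to+\infty}A(x)=0$ or $\lim_{x\to+\infty}L_j(x)=\lim_{x\to+\infty}U_j(x)$ for all $j=1,\dots,\eta$] and [$\lim_{x\to+\infty}W(x)=0$ or $\lim_{x\to+\infty}M_j(x)=\lim_{x\to+\infty}V_j(x)$ for all $j=1,\dots,\eta$]; (cc4) if $\lim_{x\to+\infty}W(x)=\lim_{x\to+\infty}A(x)\neq 0$, then $\lim_{x\to+\infty}U_j(x)=\lim_{x\to+\infty}V_j(x)$ and $\lim_{x\to+\infty}M_j(x)=\lim_{x\to+\infty}L_j(x)$ for all $j=1,\dots,\eta$; (cc5) $\lim_{x\to+\infty}M_j(x)\le\lim_{x\to+\infty}V_j(x)$ for all $j=1,\dots,\eta$, and if $\lim_{x\to+\infty}A(x)\neq 0$, then $\lim_{x\to-\infty}L_j(x)\le\lim_{x\to-\infty}U_j(x)$ for all $j=1,\dots,\eta$;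 (cc6) $\lim_{x\to-\infty}V_\eta(x)\ge\sup\{x\in\mathbb{R}:\varphi(x)<1\}$ and $\lim_{x\to-\infty}M_1(x)\le\inf\{x\in\mathbb{R}:\varphi(x)>0\}$; (cc7) $\lim_{x\to-\infty}W(x)=1$; (cc8) $\lim_{x\to-\infty}A(x)=0$ or $\lim_{x\to-\infty}L_j(x)=\lim_{x\to-\infty}U_j(x)$ for all $j=1,\dots,\eta$; (cc9) if $\eta\ge 2$, $\lim_{x\to-\infty}V_j(x)=\lim_{x\to-\infty}M_{j+1}(x)$ for all $j=1,\dots,\eta-1$; (cc10) either $\varphi$ has no points of discontinuity, or, for every $j$ and every $x_0\in\mathbb{R}$ such that $L_j(x_0)$ (respectively $V_j(x_0)$) is a point of discontinuity of $\varphi$, the function $L_j$ (respectively $V_j$) is continuous at $x_0$ and constant on $[x_0,x_0+\delta)$ for some $\delta>0$. Moreover, $\varphi$ has no point of discontinuity in the set consisting of all the limits $\lim_{x\to\pm\infty}L_j(x)$, $\lim_{x\to\pm\infty}U_j(x)$, $\lim_{x\to\pm\infty}M_j(x)$, $\lim_{x\to\pm\infty}V_j(x)$, $j=1,\dots,\eta$. Then $$H(x)=1-W(x)\sum_{j=1}^{\eta}\int_{M_j(x)}^{V_j(x)}d\varphi(t)+A(x)\sum_{j=1}^{\eta}\int_{L_j(x)}^{U_j(x)}d\varphi(t)$$ is a cumulative distribution function.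
   Context: A cumulative distribution function (cdf) is a non-decreasing right continuous function $F:\mathbb{R}\to\mathbb{R}$ with $\lim_{x\to-\infty}F(x)=0$ and $\lim_{x\to+\infty}F(x)=1$. Conventions: $\varphi(-\infty)=0$, $\varphi(+\infty)=1$, and for $a,b\in\mathbb{R}\cup\{\pm\infty\}$, $\int_a^b d\varphi(t)=\varphi(b)-\varphi(a)$ (also when $a>b$). Limits, suprema, infima and right continuity of extended-real-valued functions are taken in $\mathbb{R}\cup\{\pm\infty\}$; points of discontinuity of $\varphi$ are always real numbers. *)

theory Defs
  imports Complex_Main "HOL-Library.Extended_Real"
begin

definition monotonic :: "(real \<Rightarrow> 'a::order) \<Rightarrow> bool" where
  "monotonic f \<longleftrightarrow> mono f \<or> antimono f"

definition right_continuous :: "(real \<Rightarrow> 'a::topological_space) \<Rightarrow> bool" where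
  "right_continuous f \<longleftrightarrow> (\<forall>x. continuous (at_right x) f)"

definition is_cdf :: "(real \<Rightarrow> real) \<Rightarrow> bool" where
  "is_cdf F \<longleftrightarrow> mono F \<and> right_continuous F \<and> (F \<longlongrightarrow> 0) at_bot \<and> (F \<longlongrightarrow> 1) at_top"

definition cdf_ext :: "(real \<Rightarrow> real) \<Rightarrow> ereal \<Rightarrow> real" where
  "cdf_ext \<phi> a = (case a of ereal r \<Rightarrow> \<phi> r | PInfty \<Rightarrow> 1 | MInfty \<Rightarrow> 0)"

text \<open>The integral of \<open>d\<phi>\<close> from \<open>a\<close> to \<open>b\<close> is by convention the increment
  \<open>\<phi>(b) - \<phi>(a)\<close>, whatever the order of \<open>a\<close> and \<open>b\<close>.\<close>

definition dint :: "(real \<Rightarrow> real) \<Rightarrow> ereal \<Rightarrow> ereal \<Rightarrow> real" where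
  "dint \<phi> a b = cdf_ext \<phi> b - cdf_ext \<phi> a"

definition discontinuities :: "(real \<Rightarrow> real) \<Rightarrow> ereal set" where
  "discontinuities \<phi> = ereal ` {c. \<not> isCont \<phi> c}"

text \<open>Limits at the two ends are taken in the extended reals. They are only applied to
  monotonic functions, for which they exist, so that the underlying definite
  description is meaningful. A real-valued function is first composed with
  \<open>ereal\<close>, because its limit may be infinite.\<close>

abbreviation lim_top :: "(real \<Rightarrow> ereal) \<Rightarrow> ereal" where
  "lim_top f \<equiv> Lim at_top f"

abbreviation lim_bot :: "(real \<Rightarrow> ereal) \<Rightarrow> ereal" where
  "lim_bot f \<equiv> Lim at_bot f"

end

theory Submission
  imports Defs
begin

text \<open>At the left end the \<open>W\<close>-sum telescopes to \<open>1\<close>. At the right end (cc3)-(cc4) leave either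
  no contribution from both products, or make them equal, so that they cancel; an infinite limit of
  \<open>A\<close> is harmless because it forces \<open>L\<^sub>j = U\<^sub>j\<close> to be constant. Condition (cc10) is what
  lets limits pass through \<open>\<phi>\<close>: the non-increasing \<open>L\<^sub>j\<close> and \<open>V\<^sub>j\<close> approach their right
  limits from below, where \<open>\<phi>\<close> need not be continuous, and the limits at the two ends
  may be approached from below as well.\<close>

subsection \<open>Limits of monotone functions\<close>

lemma mono_tendsto_SUP_at_top:
  fixes f :: "'a::linorder \<Rightarrow> 'b::{complete_linorder, linorder_topology}"
  assumes "mono f"
  shows "(f \<longlongrightarrow> (SUP x. f x)) at_top"
proof (rule order_tendstoI)
  fix a assume "a < (SUP x. f x)"
  then obtain x where "a < f x" by (auto simp: less_SUP_iff)
  then show "\<forall>\<^sub>F y in at_top. a < f y"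
    by (intro eventually_mono[OF eventually_ge_at_top[of x]])
      (auto intro: less_le_trans monoD[OF assms])
next
  fix a assume "(SUP x. f x) < a"
  then have "\<And>x. f x < a" by (meson SUP_upper UNIV_I le_less_trans)
  then show "\<forall>\<^sub>F y in at_top. f y < a" by simp
qed

lemma antimono_tendsto_INF_at_top:
  fixes f :: "'a::linorder \<Rightarrow> 'b::{complete_linorder, linorder_topology}"
  assumes "antimono f"
  shows "(f \<longlongrightarrow> (INF x. f x)) at_top"
proof (rule order_tendstoI)
  fix a assume "(INF x. f x) < a"
  then obtain x where "f x < a" by (auto simp: INF_less_iff)
  then show "\<forall>\<^sub>F y in at_top. f y < a"
    by (intro eventually_mono[OF eventually_ge_at_top[of x]])
      (auto intro: le_less_trans antimonoD[OF assms])
next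
  fix a assume "a < (INF x. f x)"
  then have "\<And>x. a < f x" by (meson INF_lower UNIV_I less_le_trans)
  then show "\<forall>\<^sub>F y in at_top. a < f y" by simp
qed

context
  fixes f :: "real \<Rightarrow> 'b::{complete_linorder, linorder_topology}"
begin

text \<open>Reflection at the origin reduces the left end to the right end.\<close>

lemma mono_tendsto_INF_at_bot: "mono f \<Longrightarrow> (f \<longlongrightarrow> (INF x. f x)) at_bot"
proof -
  assume "mono f"
  then have "antimono (\<lambda>x. f (- x))" by (auto simp: mono_def antimono_def)
  moreover have "(INF x. f (- x)) = (INF x. f x)"
    using surj_uminus by (metis image_image)
  ultimately show ?thesis
    using antimono_tendsto_INF_at_top[of "\<lambda>x. f (- x)"] by (simp add: filterlim_at_bot_mirror)
qed

lemma antimono_tendsto_SUP_at_bot: "antimono f \<Longrightarrow> (f \<longlongrightarrow> (SUP x. f x)) at_bot"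
proof -
  assume "antimono f"
  then have "mono (\<lambda>x. f (- x))" by (auto simp: mono_def antimono_def)
  moreover have "(SUP x. f (- x)) = (SUP x. f x)"
    using surj_uminus by (metis image_image)
  ultimately show ?thesis
    using mono_tendsto_SUP_at_top[of "\<lambda>x. f (- x)"] by (simp add: filterlim_at_bot_mirror)
qed

text \<open>\<open>Lim\<close> is a definite description. A monotone function converges to its
  supremum or infimum and limits are unique, so \<open>Lim\<close> denotes that value, which bounds
  every \<open>f x\<close>.\<close>

lemma mono_Lim:
  assumes "mono f"
  shows "(f \<longlongrightarrow> Lim at_top f) at_top" "f x \<le> Lim at_top f"
    and "(f \<longlongrightarrow> Lim at_bot f) at_bot" "Lim at_bot f \<le> f x"
  using mono_tendsto_SUP_at_top[OF assms] mono_tendsto_INF_at_bot[OF assms]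
  by (auto simp: tendsto_Lim intro: SUP_upper INF_lower)

lemma antimono_Lim:
  assumes "antimono f"
  shows "(f \<longlongrightarrow> Lim at_top f) at_top" "Lim at_top f \<le> f x"
    and "(f \<longlongrightarrow> Lim at_bot f) at_bot" "f x \<le> Lim at_bot f"
  using antimono_tendsto_INF_at_top[OF assms] antimono_tendsto_SUP_at_bot[OF assms]
  by (auto simp: tendsto_Lim intro: SUP_upper INF_lower)

end

text \<open>A non-decreasing \<open>f\<close> sends the points right of \<open>x\<close> into the
  closed ray above \<open>f x\<close>, so one-sided continuity of \<open>g\<close> is enough. This
  serves \<open>U j\<close> and \<open>M j\<close>.\<close>

lemma right_continuousI_mono_compose:
  fixes f :: "real \<Rightarrow> 'a::linorder_topology" and g :: "'a \<Rightarrow> 'b::topological_space"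
  assumes "mono f" and "continuous (at_right x) f" and g: "continuous (at_right (f x)) g"
  shows "continuous (at_right x) (\<lambda>x. g (f x))"
proof (rule continuous_within_compose2[OF assms(2)])
  have "at (f x) within f ` {x<..} \<le> at_right (f x)"
    unfolding at_within_Ici_at_right[symmetric]
    by (rule at_le) (auto intro: monoD[OF assms(1)])
  then show "continuous (at (f x) within f ` {x<..}) g"
    using g unfolding continuous_within by (rule tendsto_mono)
qed

text \<open>Neighbouring terms cancel. It is meant for the values of \<phi> at the left limits of
  \<open>V j\<close> and \<open>M j\<close>, where the matching condition comes from (cc9).\<close>

lemma sum_telescope_matching:
  fixes f g :: "nat \<Rightarrow> 'a::ab_group_add"
  assumes "1 \<le> n" and "\<And>j. 1 \<le> j \<Longrightarrow> j < n \<Longrightarrow> g j = f (j + 1)"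
  shows "(\<Sum>j=1..n. g j - f j) = g n - f 1"
  using assms by (induction n rule: nat_induct_at_least) auto

subsection \<open>Extended distribution functions\<close>

context
  fixes \<phi> :: "real \<Rightarrow> real"
  assumes cdf: "is_cdf \<phi>"
begin

lemma cdf_nonneg: "0 \<le> \<phi> x"
proof (rule tendsto_upperbound)
  show "(\<phi> \<longlongrightarrow> 0) at_bot" using cdf by (simp add: is_cdf_def)
  show "\<forall>\<^sub>F y in at_bot. \<phi> y \<le> \<phi> x"
    using cdf by (intro eventually_mono[OF eventually_le_at_bot[of x]]) (auto simp: is_cdf_def intro: monoD)
qed simp

lemma cdf_le_1: "\<phi> x \<le> 1"
proof (rule tendsto_lowerbound)
  show "(\<phi> \<longlongrightarrow> 1) at_top" using cdf by (simp add: is_cdf_def)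
  show "\<forall>\<^sub>F y in at_top. \<phi> x \<le> \<phi> y"
    using cdf by (intro eventually_mono[OF eventually_ge_at_top[of x]]) (auto simp: is_cdf_def intro: monoD)
qed simp

lemma mono_cdf_ext: "mono (cdf_ext \<phi>)"
proof (rule monoI)
  fix a b :: ereal assume "a \<le> b"
  then show "cdf_ext \<phi> a \<le> cdf_ext \<phi> b"
    using cdf cdf_nonneg cdf_le_1
    by (cases a; cases b) (auto simp: cdf_ext_def is_cdf_def dest: monoD)
qed

text \<open>Right continuity survives the extension: at minus infinity it is the limit 0 of \<phi>,
  and to the right of plus infinity there is no point.\<close>

lemma continuous_at_right_cdf_ext: "continuous (at_right a) (cdf_ext \<phi>)"
proof (cases a)
  case (real r)
  have "(\<phi> \<longlongrightarrow> \<phi> r) (at_right r)"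
    using cdf by (simp add: is_cdf_def right_continuous_def continuous_within)
  then show ?thesis
    unfolding real continuous_within unfolding at_right_ereal filterlim_filtermap by (simp add: cdf_ext_def)
next
  case PInf
  then show ?thesis
    using trivial_limit_at_right_top[where 'a=ereal]
    by (simp add: continuous_within top_ereal_def)
next
  case MInf
  then show ?thesis
    using cdf unfolding MInf continuous_within unfolding at_right_MInf filterlim_filtermap
    by (simp add: cdf_ext_def is_cdf_def)
qed

text \<open>At the infinite points the conventional values agree with the limits of \<phi>, so only
  real jumps of \<phi> can spoil continuity.\<close>

lemma isCont_cdf_ext:
  assumes "a \<notin> discontinuities \<phi>"
  shows "isCont (cdf_ext \<phi>) a"
proof (cases a)
  case (real r)
  then have "(\<phi> \<longlongrightarrow> \<phi> r) (at r)"
    using assms by (auto simp: discontinuities_def isCont_def)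
  then show ?thesis
    unfolding real isCont_def unfolding at_ereal filterlim_filtermap by (simp add: cdf_ext_def)
next
  case PInf
  then have "continuous (at_left a) (cdf_ext \<phi>)"
    using cdf unfolding PInf continuous_within unfolding at_left_PInf filterlim_filtermap
    by (simp add: cdf_ext_def is_cdf_def)
  then show ?thesis
    using continuous_at_right_cdf_ext by (simp add: continuous_at_split)
next
  case MInf
  then have "continuous (at_left a) (cdf_ext \<phi>)"
    using trivial_limit_at_left_bot[where 'a=ereal]
    by (simp add: continuous_within bot_ereal_def)
  then show ?thesis
    using continuous_at_right_cdf_ext by (simp add: continuous_at_split)
qed

lemma cdf_ext_tendsto:
  "(f \<longlongrightarrow> l) F \<Longrightarrow> l \<notin> discontinuities \<phi> \<Longrightarrow> ((\<lambda>x. cdf_ext \<phi> (f x)) \<longlongrightarrow> cdf_ext \<phi> l) F"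
  by (rule isCont_tendsto_compose[OF isCont_cdf_ext])

text \<open>Serves the non-increasing \<open>L j\<close> and \<open>V j\<close>, whose values come
  from below. Either the extension is continuous at \<open>f x\<close>, or \<open>f\<close> stays
  constant just after \<open>x\<close> and the jump is not seen.\<close>

lemma continuous_cdf_ext_compose:
  fixes f :: "real \<Rightarrow> ereal"
  assumes "continuous (at_right x) f"
    and "f x \<in> discontinuities \<phi> \<Longrightarrow> \<exists>\<delta>>0. \<forall>y\<in>{x..<x + \<delta>}. f y = f x"
  shows "continuous (at_right x) (\<lambda>y. cdf_ext \<phi> (f y))"
proof (cases "f x \<in> discontinuities \<phi>")
  case True
  then obtain \<delta> where "\<delta> > 0" and \<delta>: "\<And>y. y \<in> {x..<x + \<delta>} \<Longrightarrow> f y = f x"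
    using assms(2) by blast
  have "\<forall>\<^sub>F y in at_right x. cdf_ext \<phi> (f y) = cdf_ext \<phi> (f x)"
  proof (rule eventually_at_rightI)
    fix y assume "y \<in> {x<..<x + \<delta>}"
    then have "f y = f x" by (intro \<delta>) auto
    then show "cdf_ext \<phi> (f y) = cdf_ext \<phi> (f x)" by (rule arg_cong)
  qed (use \<open>\<delta> > 0\<close> in simp)
  then show ?thesis
    unfolding continuous_within by (rule tendsto_eventually)
next
  case False
  then show ?thesis
    using assms(1) unfolding continuous_within by (rule cdf_ext_tendsto[rotated])
qed

text \<open>Right of a real \<open>a\<close> the function \<phi> equals 1, and right continuity
  passes this value on to \<open>a\<close>. Minus infinity is excluded because \<phi> is below 1 far
  to the left.\<close>

lemma cdf_ext_eq_1:
  assumes "(SUP x\<in>{x. \<phi> x < 1}. ereal x) \<le> a"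
  shows "cdf_ext \<phi> a = 1"
proof (cases a)
  case (real r)
  have "\<phi> y = 1" if "r < y" for y
  proof (rule ccontr)
    assume "\<phi> y \<noteq> 1"
    then have "y \<in> {x. \<phi> x < 1}" using cdf_le_1[of y] by simp
    then have "ereal y \<le> a" using assms by (simp add: SUP_le_iff)
    then show False using that real by simp
  qed
  then have "(\<phi> \<longlongrightarrow> 1) (at_right r)"
    by (intro tendsto_eventually) (auto simp: eventually_at_filter)
  moreover have "(\<phi> \<longlongrightarrow> \<phi> r) (at_right r)"
    using cdf by (simp add: is_cdf_def right_continuous_def continuous_within)
  ultimately have "\<phi> r = 1"
    using tendsto_unique trivial_limit_at_right_real by blast
  then show ?thesis by (simp add: real cdf_ext_def)
next
  case PInf
  then show ?thesis by (simp add: cdf_ext_def)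
next
  case MInf
  have "\<forall>\<^sub>F x in at_bot. \<phi> x < 1"
    using cdf by (intro order_tendstoD(2)[of \<phi> 0]) (auto simp: is_cdf_def)
  then obtain x where "\<phi> x < 1"
    by (auto dest: eventually_happens)
  then have "ereal x \<le> a" using assms by (simp add: SUP_le_iff)
  then show ?thesis using MInf by simp
qed

text \<open>Left of a real \<open>a\<close> the function \<phi> vanishes, but it could jump at
  \<open>a\<close> itself; continuity there rules this out.\<close>

lemma cdf_ext_eq_0:
  assumes "a \<le> (INF x\<in>{x. \<phi> x > 0}. ereal x)" and "a \<notin> discontinuities \<phi>"
  shows "cdf_ext \<phi> a = 0"
proof (cases a)
  case (real r)
  have "\<phi> y = 0" if "y < r" for y
  proof (rule ccontr)
    assume "\<phi> y \<noteq> 0"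
    then have "y \<in> {x. \<phi> x > 0}" using cdf_nonneg[of y] by simp
    then have "a \<le> ereal y" using assms(1) by (simp add: le_INF_iff)
    then show False using that real by simp
  qed
  then have "(\<phi> \<longlongrightarrow> 0) (at_left r)"
    by (intro tendsto_eventually) (auto simp: eventually_at_filter)
  moreover have "isCont \<phi> r"
    using assms(2) real by (auto simp: discontinuities_def)
  then have "(\<phi> \<longlongrightarrow> \<phi> r) (at_left r)"
    using continuous_at_split continuous_within by blast
  ultimately have "\<phi> r = 0"
    using tendsto_unique trivial_limit_at_left_real by blast
  then show ?thesis by (simp add: real cdf_ext_def)
next
  case PInf
  have "\<forall>\<^sub>F x in at_top. 0 < \<phi> x"
    using cdf by (intro order_tendstoD(1)[of \<phi> 1]) (auto simp: is_cdf_def)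
  then obtain x where "0 < \<phi> x"
    by (auto dest: eventually_happens)
  then have "a \<le> ereal x" using assms(1) by (simp add: le_INF_iff)
  then show ?thesis using PInf by simp
next
  case MInf
  then show ?thesis by (simp add: cdf_ext_def)
qed

lemma dint_mono: "a' \<le> a \<Longrightarrow> b \<le> b' \<Longrightarrow> dint \<phi> a b \<le> dint \<phi> a' b'"
  unfolding dint_def by (intro diff_mono monoD[OF mono_cdf_ext])

lemma dint_nonneg: "a \<le> b \<Longrightarrow> 0 \<le> dint \<phi> a b"
  using monoD[OF mono_cdf_ext] by (simp add: dint_def)

lemma dint_tendsto:
  assumes "(f \<longlongrightarrow> a) F" "(g \<longlongrightarrow> b) F" "a \<notin> discontinuities \<phi>" "b \<notin> discontinuities \<phi>"
  shows "((\<lambda>x. dint \<phi> (f x) (g x)) \<longlongrightarrow> dint \<phi> a b) F"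
  unfolding dint_def by (intro tendsto_diff cdf_ext_tendsto assms)

end

theorem corollary1p1:
  fixes \<eta> :: nat
    and \<phi> A W :: "real \<Rightarrow> real"
    and U L M V :: "nat \<Rightarrow> real \<Rightarrow> ereal"
  assumes eta: "\<eta> \<ge> 1"
    and mono_real: "monotonic \<phi>" "monotonic A" "monotonic W"
    and mono_ereal: "\<forall>j\<in>{1..\<eta>}. monotonic (U j) \<and> monotonic (L j) \<and> monotonic (M j) \<and> monotonic (V j)"
    and rc_real: "right_continuous \<phi>" "right_continuous A" "right_continuous W"
    and rc_ereal: "\<forall>j\<in>{1..\<eta>}. right_continuous (U j) \<and> right_continuous (L j)
        \<and> right_continuous (M j) \<and> right_continuous (V j)"
    and cc1: "is_cdf \<phi>" "\<forall>x. A x \<ge> 0" "\<forall>x. W x \<ge> 0"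
    and cc2: "mono A" "antimono W"
        "\<forall>j\<in>{1..\<eta>}. mono (U j) \<and> mono (M j) \<and> antimono (V j) \<and> antimono (L j)"
    and cc3: "lim_top (\<lambda>x. ereal (W x)) \<noteq> lim_top (\<lambda>x. ereal (A x)) \<longrightarrow>
        (lim_top (\<lambda>x. ereal (A x)) = 0 \<or> (\<forall>j\<in>{1..\<eta>}. lim_top (L j) = lim_top (U j))) \<and>
        (lim_top (\<lambda>x. ereal (W x)) = 0 \<or> (\<forall>j\<in>{1..\<eta>}. lim_top (M j) = lim_top (V j)))"
    and cc4: "lim_top (\<lambda>x. ereal (W x)) = lim_top (\<lambda>x. ereal (A x)) \<and>
        lim_top (\<lambda>x. ereal (A x)) \<noteq> 0 \<longrightarrow>
        (\<forall>j\<in>{1..\<eta>}. lim_top (U j) = lim_top (V j) \<and> lim_top (M j) = lim_top (L j))"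
    and cc5: "\<forall>j\<in>{1..\<eta>}. lim_top (M j) \<le> lim_top (V j)"
        "lim_top (\<lambda>x. ereal (A x)) \<noteq> 0 \<longrightarrow> (\<forall>j\<in>{1..\<eta>}. lim_bot (L j) \<le> lim_bot (U j))"
    and cc6: "lim_bot (V \<eta>) \<ge> (SUP x\<in>{x. \<phi> x < 1}. ereal x)"
        "lim_bot (M 1) \<le> (INF x\<in>{x. \<phi> x > 0}. ereal x)"
    and cc7: "lim_bot (\<lambda>x. ereal (W x)) = 1"
    and cc8: "lim_bot (\<lambda>x. ereal (A x)) = 0 \<or> (\<forall>j\<in>{1..\<eta>}. lim_bot (L j) = lim_bot (U j))"
    and cc9: "\<eta> \<ge> 2 \<longrightarrow> (\<forall>j\<in>{1..\<eta> - 1}. lim_bot (V j) = lim_bot (M (j + 1)))"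
    and cc10: "discontinuities \<phi> = {} \<or>
        (\<forall>j\<in>{1..\<eta>}. \<forall>x0.
          (L j x0 \<in> discontinuities \<phi> \<longrightarrow>
            isCont (L j) x0 \<and> (\<exists>\<delta>>0. \<forall>x\<in>{x0..<x0 + \<delta>}. L j x = L j x0)) \<and>
          (V j x0 \<in> discontinuities \<phi> \<longrightarrow>
            isCont (V j) x0 \<and> (\<exists>\<delta>>0. \<forall>x\<in>{x0..<x0 + \<delta>}. V j x = V j x0)))"
        "discontinuities \<phi> \<inter> (\<Union>j\<in>{1..\<eta>}.
          {lim_bot (L j), lim_top (L j), lim_bot (U j), lim_top (U j),
           lim_bot (M j), lim_top (M j), lim_bot (V j), lim_top (V j)}) = {}"
  shows "is_cdf (\<lambda>x. 1 - W x * (\<Sum>j=1..\<eta>. dint \<phi> (M j x) (V j x))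
                       + A x * (\<Sum>j=1..\<eta>. dint \<phi> (L j x) (U j x)))"
proof -

  \<comment> \<open>Notation and the order of the integration bounds\<close>
  define SW SA where "SW x = (\<Sum>j=1..\<eta>. dint \<phi> (M j x) (V j x))"
    and "SA x = (\<Sum>j=1..\<eta>. dint \<phi> (L j x) (U j x))" for x
  have cont [simp]: "lim_bot (L j) \<notin> discontinuities \<phi>" "lim_top (L j) \<notin> discontinuities \<phi>"
    "lim_bot (U j) \<notin> discontinuities \<phi>" "lim_top (U j) \<notin> discontinuities \<phi>"
    "lim_bot (M j) \<notin> discontinuities \<phi>" "lim_top (M j) \<notin> discontinuities \<phi>"
    "lim_bot (V j) \<notin> discontinuities \<phi>" "lim_top (V j) \<notin> discontinuities \<phi>"
    if "j \<in> {1..\<eta>}" for j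
    using that cc10(2) by blast+
  have mono [simp]: "mono (U j)" "mono (M j)" "antimono (V j)" "antimono (L j)"
    if "j \<in> {1..\<eta>}" for j
    using that cc2(3) by auto
  \<comment> \<open>The embedding into \<open>ereal\<close> gives \<open>A\<close>, which may be
    unbounded, a limit at the right end.\<close>
  have mono_A: "mono (\<lambda>x. ereal (A x))" and anti_W: "antimono (\<lambda>x. ereal (W x))"
    using cc2(1,2) by (auto simp: mono_def antimono_def)

  \<comment> \<open>\<open>A\<close> lies between 0 and its right limit. This settles the case in
    which (cc5) does not compare \<open>L j\<close> with \<open>U j\<close>.\<close>
  have A_zero: "A x = 0" if "lim_top (\<lambda>x. ereal (A x)) = 0" for x
    using mono_Lim(2)[OF mono_A, of x] that cc1(2) by (simp add: order_antisym)
  \<comment> \<open>\<open>M j\<close> rises and \<open>V j\<close> falls towards the right, so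
    their order at plus infinity holds everywhere.\<close>
  have MV: "M j x \<le> V j x" if "j \<in> {1..\<eta>}" for j x
  proof -
    have "M j x \<le> lim_top (M j)" using that by (simp add: mono_Lim)
    also have "\<dots> \<le> lim_top (V j)" using that cc5(1) by blast
    also have "\<dots> \<le> V j x" using that by (simp add: antimono_Lim)
    finally show ?thesis .
  qed
  \<comment> \<open>Here the bounds move apart to the right, so the order at minus infinity is the
    one that propagates.\<close>
  have LU: "L j x \<le> U j x" if "lim_top (\<lambda>x. ereal (A x)) \<noteq> 0" "j \<in> {1..\<eta>}" for j x
  proof -
    have "L j x \<le> lim_bot (L j)" using that by (simp add: antimono_Lim)
    also have "\<dots> \<le> lim_bot (U j)" using that cc5(2) by blast
    also have "\<dots> \<le> U j x" using that by (simp add: mono_Lim)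
    finally show ?thesis .
  qed

  \<comment> \<open>Monotonicity\<close>
  have mono_H: "mono (\<lambda>x. 1 - W x * SW x + A x * SA x)"
  proof (rule monoI)
    fix x y :: real assume "x \<le> y"
    note mono_UMVL = monoD[OF mono(1)] monoD[OF mono(2)] antimonoD[OF mono(3)] antimonoD[OF mono(4)]
    \<comment> \<open>Both factors are non-negative and non-increasing, since the interval from
      \<open>M j\<close> to \<open>V j\<close> shrinks.\<close>
    have "W y * SW y \<le> W x * SW x"
    proof (rule mult_mono)
      show "SW y \<le> SW x"
        unfolding SW_def using \<open>x \<le> y\<close>
        by (intro sum_mono dint_mono[OF cc1(1)] mono_UMVL)
      show "0 \<le> SW y"
        unfolding SW_def by (intro sum_nonneg dint_nonneg[OF cc1(1)] MV)
    qed (use cc1(3) antimonoD[OF cc2(2) \<open>x \<le> y\<close>] in auto)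
    moreover have "A x * SA x \<le> A y * SA y"
    proof (cases "lim_top (\<lambda>x. ereal (A x)) = 0")
      case True
      then show ?thesis by (simp add: A_zero[OF True])
    next
      case False
      show ?thesis
      proof (rule mult_mono)
        show "SA x \<le> SA y"
          unfolding SA_def using \<open>x \<le> y\<close>
          by (intro sum_mono dint_mono[OF cc1(1)] mono_UMVL)
        show "0 \<le> SA x"
          unfolding SA_def by (intro sum_nonneg dint_nonneg[OF cc1(1)] LU[OF False])
      qed (use cc1(2) monoD[OF cc2(1) \<open>x \<le> y\<close>] in auto)
    qed
    ultimately show "1 - W x * SW x + A x * SA x \<le> 1 - W y * SW y + A y * SA y" by simp
  qed

  \<comment> \<open>Right continuity\<close>
  have rc_H: "right_continuous (\<lambda>x. 1 - W x * SW x + A x * SA x)"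
  proof -
    have "continuous (at_right x) (\<lambda>x. 1 - W x * SW x + A x * SA x)" for x
    proof -
      have rc: "continuous (at_right x) (U j)" "continuous (at_right x) (M j)"
        "continuous (at_right x) (L j)" "continuous (at_right x) (V j)" if "j \<in> {1..\<eta>}" for j
        using that rc_ereal unfolding right_continuous_def by blast+
      note up = right_continuousI_mono_compose[OF mono(1) rc(1) continuous_at_right_cdf_ext[OF cc1(1)]]
        right_continuousI_mono_compose[OF mono(2) rc(2) continuous_at_right_cdf_ext[OF cc1(1)]]
      \<comment> \<open>A jump of \<phi> at \<open>L j x\<close> refutes the first alternative of
        (cc10), so the second one supplies \<delta>.\<close>
      have const: "\<exists>\<delta>>0. \<forall>y\<in>{x..<x + \<delta>}. L j y = L j x"
        if "j \<in> {1..\<eta>}" "L j x \<in> discontinuities \<phi>" for j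
        using that cc10(1) by blast
      have const': "\<exists>\<delta>>0. \<forall>y\<in>{x..<x + \<delta>}. V j y = V j x"
        if "j \<in> {1..\<eta>}" "V j x \<in> discontinuities \<phi>" for j
        using that cc10(1) by blast
      note down = continuous_cdf_ext_compose[OF cc1(1) rc(3) const]
        continuous_cdf_ext_compose[OF cc1(1) rc(4) const']
      show ?thesis
        unfolding SW_def SA_def dint_def
        by (intro continuous_add continuous_diff continuous_mult continuous_sum continuous_const up down)
          (use rc_real(2,3) in \<open>auto simp: right_continuous_def\<close>)
    qed
    then show ?thesis by (simp add: right_continuous_def)
  qed

  \<comment> \<open>Limit at minus infinity\<close>
  have bot_H: "((\<lambda>x. 1 - W x * SW x + A x * SA x) \<longlongrightarrow> 0) at_bot"
  proof -
    have W: "(W \<longlongrightarrow> 1) at_bot"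
      using antimono_Lim(3)[OF anti_W] cc7 by (simp add: one_ereal_def)
    have SW: "(SW \<longlongrightarrow> (\<Sum>j=1..\<eta>. dint \<phi> (lim_bot (M j)) (lim_bot (V j)))) at_bot"
      unfolding SW_def
      by (intro tendsto_sum dint_tendsto[OF cc1(1)] mono_Lim antimono_Lim) simp_all
    have sum_1: "(\<Sum>j=1..\<eta>. dint \<phi> (lim_bot (M j)) (lim_bot (V j))) = 1"
    proof -
      have "(\<Sum>j=1..\<eta>. dint \<phi> (lim_bot (M j)) (lim_bot (V j)))
          = cdf_ext \<phi> (lim_bot (V \<eta>)) - cdf_ext \<phi> (lim_bot (M 1))"
        unfolding dint_def using eta cc9 by (intro sum_telescope_matching) auto
      then show ?thesis
        using cdf_ext_eq_1[OF cc1(1) cc6(1)] cdf_ext_eq_0[OF cc1(1) cc6(2)] eta by simp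
    qed
    have "((\<lambda>x. A x * SA x) \<longlongrightarrow> 0) at_bot"
    proof -
      \<comment> \<open>The left limit of \<open>A\<close> is finite, being between 0 and
        \<open>A 0\<close>.\<close>
      obtain a where a: "lim_bot (\<lambda>x. ereal (A x)) = ereal a"
      proof (cases "lim_bot (\<lambda>x. ereal (A x))")
        case MInf
        have "0 \<le> lim_bot (\<lambda>x. ereal (A x))"
          using cc1(2) by (intro tendsto_lowerbound[OF mono_Lim(3)[OF mono_A]]) auto
        then show ?thesis using MInf by simp
      qed (use mono_Lim(4)[OF mono_A, of 0] in auto)
      define s where "s = (\<Sum>j=1..\<eta>. dint \<phi> (lim_bot (L j)) (lim_bot (U j)))"
      have "(A \<longlongrightarrow> a) at_bot"
        using mono_Lim(3)[OF mono_A] a by simp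
      moreover have "(SA \<longlongrightarrow> s) at_bot"
        unfolding SA_def s_def
        by (intro tendsto_sum dint_tendsto[OF cc1(1)] mono_Lim antimono_Lim) simp_all
      \<comment> \<open>By (cc8) either \<open>a\<close> is 0 or every integral in \<open>s\<close>
        has equal bounds.\<close>
      moreover have "a * s = 0"
        using cc8 a by (auto simp: s_def dint_def zero_ereal_def)
      ultimately show ?thesis by (metis tendsto_mult)
    qed
    from tendsto_add[OF tendsto_diff[OF tendsto_const[of 1] tendsto_mult[OF W SW[unfolded sum_1]]] this]
    show ?thesis by simp
  qed

  \<comment> \<open>Limit at plus infinity\<close>
  have top_H: "((\<lambda>x. 1 - W x * SW x + A x * SA x) \<longlongrightarrow> 1) at_top"
  proof -
    \<comment> \<open>\<open>W\<close> falls and stays non-negative, so its limit is between 0 and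
      \<open>W 0\<close>; for \<open>A\<close> no such bound is available.\<close>
    obtain w where w: "lim_top (\<lambda>x. ereal (W x)) = ereal w"
    proof (cases "lim_top (\<lambda>x. ereal (W x))")
      case MInf
      have "0 \<le> lim_top (\<lambda>x. ereal (W x))"
        using cc1(3) by (intro tendsto_lowerbound[OF antimono_Lim(1)[OF anti_W]]) auto
      then show ?thesis using MInf by simp
    qed (use antimono_Lim(2)[OF anti_W, of 0] in auto)
    define s where "s = (\<Sum>j=1..\<eta>. dint \<phi> (lim_top (M j)) (lim_top (V j)))"
    have W: "(W \<longlongrightarrow> w) at_top"
      using antimono_Lim(1)[OF anti_W] w by simp
    have SW: "(SW \<longlongrightarrow> s) at_top"
      unfolding SW_def s_def
      by (intro tendsto_sum dint_tendsto[OF cc1(1)] mono_Lim antimono_Lim) simp_all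
    \<comment> \<open>The target \<open>w * s\<close> is the limit of \<open>W x * SW x\<close>, so
      the two products cancel in the limit, whichever case of (cc3) and (cc4) applies.\<close>
    have "((\<lambda>x. A x * SA x) \<longlongrightarrow> w * s) at_top"
    proof (cases "lim_top (\<lambda>x. ereal (W x)) = lim_top (\<lambda>x. ereal (A x))")
      case eq: True
      show ?thesis
      proof (cases "lim_top (\<lambda>x. ereal (A x)) = 0")
        case True
        then have "w = 0" using eq w by simp
        then show ?thesis using A_zero[OF True] by simp
      next
        case False
        have "(A \<longlongrightarrow> w) at_top"
          using mono_Lim(1)[OF mono_A] w eq by simp
        moreover have "(SA \<longlongrightarrow> (\<Sum>j=1..\<eta>. dint \<phi> (lim_top (L j)) (lim_top (U j)))) at_top"
          unfolding SA_def
          by (intro tendsto_sum dint_tendsto[OF cc1(1)] mono_Lim antimono_Lim) simp_all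
        \<comment> \<open>(cc4) identifies the bounds term by term: \<open>L j\<close> with
          \<open>M j\<close>, and \<open>U j\<close> with \<open>V j\<close>.\<close>
        moreover have "(\<Sum>j=1..\<eta>. dint \<phi> (lim_top (L j)) (lim_top (U j))) = s"
          using cc4 eq False by (simp add: s_def)
        ultimately show ?thesis by (simp add: tendsto_mult)
      qed
    next
      case False
      have "w * s = 0"
      proof (cases "w = 0")
        case nz: False
        then have "\<forall>j\<in>{1..\<eta>}. lim_top (M j) = lim_top (V j)"
          using cc3 False w by (metis ereal_eq_0(1))
        then show ?thesis by (simp add: s_def dint_def)
      qed simp
      \<comment> \<open>The product is shown to vanish for every \<open>x\<close>, not just in the
        limit, because \<open>A\<close> may tend to infinity.\<close>
      moreover have "A x * SA x = 0" for x
      proof (cases "lim_top (\<lambda>x. ereal (A x)) = 0")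
        case True
        then show ?thesis by (simp add: A_zero[OF True])
      next
        case nz: False
        \<comment> \<open>The common right limit is squeezed: it is at least \<open>U j x\<close>
          and at most \<open>L j x\<close>, while \<open>LU\<close> gives the opposite
          order.\<close>
        have "L j x = U j x" if j: "j \<in> {1..\<eta>}" for j
        proof -
          have "U j x \<le> lim_top (U j)" "lim_top (L j) \<le> L j x"
            using j by (simp_all add: mono_Lim antimono_Lim)
          moreover have "lim_top (L j) = lim_top (U j)"
            using cc3 False nz j by blast
          ultimately show ?thesis using LU[OF nz j, of x] by simp
        qed
        then show ?thesis by (simp add: SA_def dint_def)
      qed
      ultimately show ?thesis by (simp only: tendsto_const)
    qed
    from tendsto_add[OF tendsto_diff[OF tendsto_const[of 1] tendsto_mult[OF W SW]] this]
    show ?thesis by simp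
  qed

  show ?thesis
    unfolding is_cdf_def SW_def[symmetric] SA_def[symmetric]
    by (intro conjI mono_H rc_H bot_H top_H)
qed

end
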